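(* Let $M\ge 0$ be an integer, $a=(a_1,\dots,a_M)$ with all $a_i>0$, $\Re(w)>0$ and $\kappa>0$, and write $\kappa a=(\kappa a_1,\dots,\kappa a_M)$. Then $$\Gamma_M(\kappa w\,|\,\kappa a)=\kappa^{-B_{M,M}(w\,|\,a)/M!}\;\Gamma_M(w\,|\,a).$$
   Context: Barnes multiple gamma function (Ruijsenaars normalization): for $a=(a_1,\dots,a_M)$, $a_j>0$, the Barnes zeta function is $\zeta_M(s,w\,|\,a)=\sum_{k_1,\dots,k_M=0}^\infty (w+k_1a_1+\cdots+k_Ma_M)^{-s}$ for $\Re(s)>M$, $\Re(w)>0$. It continues meromorphically to $s\in\mathbb{C}$ with simple poles only at $s=1,\dots,M$. Set $L_M(w\,|\,a)=\partial_s\zeta_M(s,w\,|\,a)|_{s=0}$ and $\Gamma_M(w\,|\,a)=\exp(L_M(w\,|\,a))$ for $\Re(w)>0$; for $M=0$, $\Gamma_0(w)=1/w$. Multiple Bernoulli polynomials: $B_{M,m}(x\,|\,a)=\frac{d^m}{dt^m}\Big|_{t=0}\Big[t^M\prod_{j=1}^M(1-e^{-a_jt})^{-1}e^{-xt}\Big]$. *)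

theory Defs
  imports "HOL-Complex_Analysis.Complex_Analysis"
begin

text \<open>
  A parameter tuple \<open>(a\<^sub>1, \<dots>, a\<^sub>M)\<close> is a function \<open>a :: nat \<Rightarrow> real\<close>, of which only the values
  on \<open>{1..M}\<close> are used. A multi-index \<open>(k\<^sub>1, \<dots>, k\<^sub>M)\<close> is an element of
  \<open>{1..M} \<rightarrow>\<^sub>E UNIV\<close>; for \<open>M = 0\<close> there is exactly one.
  Complex powers are taken with the principal branch, which is holomorphic on \<open>Re w > 0\<close>.
\<close>

definition barnes_zeta_series :: "nat \<Rightarrow> complex \<Rightarrow> complex \<Rightarrow> (nat \<Rightarrow> real) \<Rightarrow> complex" where
  "barnes_zeta_series M s w a =
     (\<Sum>\<^sub>\<infinity>k \<in> {1..M} \<rightarrow>\<^sub>E (UNIV :: nat set).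
        (w + (\<Sum>j=1..M. of_nat (k j) * of_real (a j))) powr (- s))"

text \<open>
  The meromorphic continuation in \<open>s\<close>. Requiring \<open>nicely_meromorphic_on\<close> (value \<open>0\<close> at poles,
  no removable discontinuities) rather than \<open>meromorphic_on\<close> makes the continuation unique as a
  function.
\<close>

definition barnes_zeta :: "nat \<Rightarrow> complex \<Rightarrow> complex \<Rightarrow> (nat \<Rightarrow> real) \<Rightarrow> complex" where
  "barnes_zeta M s w a =
     (THE Z. Z nicely_meromorphic_on UNIV \<and>
        (\<forall>s. Re s > real M \<longrightarrow> Z s = barnes_zeta_series M s w a)) s"

definition barnes_L :: "nat \<Rightarrow> complex \<Rightarrow> (nat \<Rightarrow> real) \<Rightarrow> complex" where
  "barnes_L M w a = deriv (\<lambda>s. barnes_zeta M s w a) 0"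

definition barnes_Gamma :: "nat \<Rightarrow> complex \<Rightarrow> (nat \<Rightarrow> real) \<Rightarrow> complex" where
  "barnes_Gamma M w a = (if M = 0 then 1 / w else exp (barnes_L M w a))"

text \<open>
  The generating function has a removable singularity at \<open>t = 0\<close>, where the bare HOL expression
  evaluates to \<open>0\<close> if \<open>M > 0\<close>, whence \<open>remove_sings\<close>.
\<close>

definition multiple_bernoulli :: "nat \<Rightarrow> nat \<Rightarrow> complex \<Rightarrow> (nat \<Rightarrow> real) \<Rightarrow> complex" where
  "multiple_bernoulli M m x a =
     (deriv ^^ m) (remove_sings (\<lambda>t. t ^ M *
        (\<Prod>j=1..M. inverse (1 - exp (- (of_real (a j) * t)))) * exp (- (x * t)))) 0"

end

theory Submission
  imports Defs
begin

text \<open>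
  Put \<open>v = s - M\<close> and \<open>e\<^sub>m(w) = (- d/dw)\<^sup>m w\<^sup>-\<^sup>v\<close>. A power series \<open>F\<close> acts as the differential operator
  \<open>F(- d/dw)\<close>; in this calculus translation by \<open>a\<close> is \<open>exp (- a X)\<close>, exactly up to a Taylor remainder
  of the size of \<open>e\<^sub>L\<close> once the series are truncated at order \<open>L\<close>. Hence, if
  \<open>F \<cdot> (\<Prod>j. 1 - exp (- a\<^sub>j X)) = X\<^sup>M\<close>, then the iterated difference of \<open>F w\<^sup>-\<^sup>v\<close> in the directions
  \<open>a\<^sub>1, \<dots>, a\<^sub>M\<close> agrees with \<open>e\<^sub>M(w)\<close>, a multiple of \<open>w\<^sup>-\<^sup>s\<close>, up to such a remainder. Summing over the lattice,
  the differences telescope to the single term \<open>F w\<^sup>-\<^sup>v\<close>, and the sum of the remainders converges for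
  \<open>Re s > 2 M - L\<close>; as \<open>L\<close> is arbitrary, this continues \<open>\<zeta>\<^sub>M\<close> to the whole plane. At \<open>s = 0\<close> the remainders vanish
  identically, because \<open>e\<^sub>L = 0\<close> for the polynomial \<open>w\<^sup>M\<close>, and what is left is
  \<open>\<zeta>\<^sub>M(0, w) = B\<^sub>M\<^sub>,\<^sub>M(w) / M!\<close>. The theorem follows by differentiating the homogeneity relation
  \<open>\<zeta>\<^sub>M(s, \<kappa> w | \<kappa> a) = \<kappa>\<^sup>-\<^sup>s \<zeta>\<^sub>M(s, w | a)\<close> at \<open>s = 0\<close>.
\<close>

subsection \<open>Power series acting on complex powers\<close>

text \<open>\<open>neg_deriv_powr m v w\<close> is the \<open>m\<close>-th power of \<open>- d/dw\<close> applied to \<open>w powr (- v)\<close>.\<close>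

definition neg_deriv_powr :: "nat \<Rightarrow> complex \<Rightarrow> complex \<Rightarrow> complex" where
  "neg_deriv_powr m v w = pochhammer v m * w powr (- (v + of_nat m))"

definition fps_act :: "nat \<Rightarrow> complex fps \<Rightarrow> complex \<Rightarrow> complex \<Rightarrow> complex" where
  "fps_act L F v w = (\<Sum>m<L. fps_nth F m * neg_deriv_powr m v w)"

text \<open>
  Keeping the factor \<open>pochhammer v L\<close>, instead of absorbing it into a constant depending on \<open>v\<close>,
  makes the error vanish at \<open>v = - M\<close>, that is, at \<open>s = 0\<close>.
\<close>

definition powr_err :: "nat \<Rightarrow> complex \<Rightarrow> complex \<Rightarrow> real" where
  "powr_err L v w =
     cmod (pochhammer v L) * exp (pi * \<bar>Im v\<bar>) * cmod w powr (- (Re v + real L))"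

lemma powr_err_nonneg [simp]: "powr_err L v w \<ge> 0"
  by (simp add: powr_err_def)

text \<open>The argument contributes the factor \<open>exp (Im u * Arg w)\<close>, and
  \<open>Arg w\<close> lies in (-pi, pi]. The bound is thus uniform in \<open>w\<close>, which is
  why \<open>powr_err\<close> carries \<open>exp (pi * \<bar>Im v\<bar>)\<close>.\<close>

lemma norm_powr_minus_le: "cmod (w powr (- u)) \<le> exp (pi * \<bar>Im u\<bar>) * cmod w powr (- Re u)"
proof -
  have "Im u * Arg w \<le> \<bar>Im u\<bar> * \<bar>Arg w\<bar>"
    by (metis abs_ge_self abs_mult)
  also have "\<dots> \<le> \<bar>Im u\<bar> * pi"
    using mpi_less_Arg[of w] Arg_le_pi[of w] by (intro mult_left_mono) auto
  finally have "exp (Im u * Arg w) \<le> exp (pi * \<bar>Im u\<bar>)"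
    by (simp add: mult.commute)
  then have "cmod w powr (- Re u) * exp (Im u * Arg w) \<le> cmod w powr (- Re u) * exp (pi * \<bar>Im u\<bar>)"
    by (intro mult_left_mono) auto
  then show ?thesis
    by (simp add: norm_powr_complex mult.commute)
qed

lemma norm_neg_deriv_powr_le: "cmod (neg_deriv_powr m v w) \<le> powr_err m v w"
  using norm_powr_minus_le[of w "v + of_nat m"]
  by (auto simp: neg_deriv_powr_def powr_err_def norm_mult mult.assoc intro!: mult_left_mono)

lemma powr_err_antimono:
  assumes "cmod w \<le> cmod z" "w \<noteq> 0" "Re v + real L \<ge> 0"
  shows "powr_err L v z \<le> powr_err L v w"
  unfolding powr_err_def using assms by (intro mult_left_mono powr_mono2') auto

lemma norm_le_shift:
  assumes "Re w > 0" "t \<ge> 0"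
  shows "cmod w \<le> cmod (w + of_real t)"
proof -
  have "(Re w)\<^sup>2 \<le> (Re w + t)\<^sup>2"
    using assms by (intro power_mono) auto
  then show ?thesis
    by (simp add: cmod_def)
qed

lemma neg_deriv_powr_has_field_derivative:
  assumes "Re w > 0"
  shows "(neg_deriv_powr m v has_field_derivative - neg_deriv_powr (Suc m) v w) (at w)"
proof -
  have "w \<notin> \<real>\<^sub>\<le>\<^sub>0"
    using assms by (auto simp: complex_nonpos_Reals_iff)
  then have "((\<lambda>w. pochhammer v m * w powr (- (v + of_nat m))) has_field_derivative
      pochhammer v m * (- (v + of_nat m) * w powr (- (v + of_nat m) - 1))) (at w)"
    by (intro DERIV_cmult has_field_derivative_powr)
  moreover have "- (v + of_nat m) - 1 = - (v + of_nat (Suc m))"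
    by simp
  then have "pochhammer v m * (- (v + of_nat m) * w powr (- (v + of_nat m) - 1)) =
      - neg_deriv_powr (Suc m) v w"
    by (simp only: neg_deriv_powr_def pochhammer_Suc) (simp add: algebra_simps)
  ultimately show ?thesis
    unfolding neg_deriv_powr_def [abs_def] by simp
qed

text \<open>Taylor's formula on the segment from \<open>w\<close> to \<open>w + a\<close>. Moduli
  along it are at least \<open>cmod w\<close>, so the bound at \<open>w\<close> controls the top
  derivative on the whole segment. Expanding to order \<open>L - m\<close> makes this derivative one
  of total order \<open>L\<close>, whatever \<open>m\<close> is.\<close>

lemma neg_deriv_powr_Taylor:
  assumes "Re w > 0" "a \<ge> 0" "m < L" "Re v + real L \<ge> 0"
  shows "cmod (neg_deriv_powr m v (w + of_real a) -
           (\<Sum>l<L - m. (- of_real a) ^ l / fact l * neg_deriv_powr (m + l) v w))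
         \<le> a ^ (L - m) / fact (L - m - 1) * powr_err L v w"
proof -
  define n where "n = L - m - 1"
  have n: "Suc n = L - m" "m + Suc n = L"
    using assms by (auto simp: n_def)
  define S where "S = closed_segment w (w + of_real a)"
  \<comment> \<open>The sign turns powers of - d/dx into the ordinary derivatives that
    \<open>complex_Taylor\<close> expects.\<close>
  define f where "f i x = (-1) ^ i * neg_deriv_powr (m + i) v x" for i x
  have S: "Re x > 0 \<and> cmod w \<le> cmod x" if xS: "x \<in> S" for x
  proof -
    obtain u where u: "0 \<le> u" "x = (1 - u) *\<^sub>R w + u *\<^sub>R (w + of_real a)"
      using xS unfolding S_def closed_segment_def by blast
    then have x: "x = w + of_real (u * a)"
      by (simp add: scaleR_conv_of_real algebra_simps)
    have "u * a \<ge> 0"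
      using u assms by simp
    then show ?thesis
      using assms norm_le_shift[of w "u * a"] unfolding x by (simp add: add_pos_nonneg)
  qed
  have "cmod (f 0 (w + of_real a) - (\<Sum>i\<le>n. f i w * (w + of_real a - w) ^ i / fact i))
      \<le> powr_err L v w * cmod (w + of_real a - w) ^ Suc n / fact n"
  proof (rule complex_Taylor)
    show "convex S"
      by (simp add: S_def)
    show "w \<in> S" "w + of_real a \<in> S"
      by (auto simp: S_def)
    fix x assume x: "x \<in> S"
    have "cmod (f (Suc n) x) = cmod (neg_deriv_powr L v x)"
      by (simp add: f_def norm_mult norm_power flip: n)
    also have "\<dots> \<le> powr_err L v x"
      by (rule norm_neg_deriv_powr_le)
    also have "\<dots> \<le> powr_err L v w"
      using S[OF x] assms by (intro powr_err_antimono) auto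
    finally show "cmod (f (Suc n) x) \<le> powr_err L v w" .
    fix i
    have "((\<lambda>x. (-1) ^ i * neg_deriv_powr (m + i) v x) has_field_derivative
        (-1) ^ i * (- neg_deriv_powr (Suc (m + i)) v x)) (at x within S)"
      using S[OF x] neg_deriv_powr_has_field_derivative
      by (intro DERIV_cmult) (blast intro: has_field_derivative_at_within)
    then show "(f i has_field_derivative f (Suc i) x) (at x within S)"
      by (simp add: f_def [abs_def])
  qed
  moreover have "(\<Sum>i\<le>n. f i w * (w + of_real a - w) ^ i / fact i) =
      (\<Sum>l<L - m. (- of_real a) ^ l / fact l * neg_deriv_powr (m + l) v w)"
  proof -
    have "(- 1) ^ l * (of_real a :: complex) ^ l = (- of_real a) ^ l" for l
      by (metis mult_minus1 power_mult_distrib)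
    then show ?thesis
      unfolding n(1)[symmetric] lessThan_Suc_atMost
      by (intro sum.cong refl) (simp add: f_def mult_ac)
  qed
  ultimately show ?thesis
    using assms by (simp add: n(1) f_def norm_power) (simp add: n_def mult_ac)
qed

text \<open>Cutting the Cauchy product at total degree \<open>L\<close> leaves the triangle
  \<open>m + l < L\<close>, whose row \<open>m\<close> is the Taylor polynomial of order
  \<open>L - m\<close>. Only Taylor remainders are left over. That \<open>C\<close> depends on
  neither \<open>v\<close> nor \<open>w\<close> is what later gives convergence uniform in
  \<open>v\<close>.\<close>

lemma fps_act_shift:
  assumes "a \<ge> 0"
  obtains C where "C \<ge> 0"
    "\<And>v w. Re w > 0 \<Longrightarrow> Re v + real L \<ge> 0 \<Longrightarrow>
       cmod (fps_act L F v (w + of_real a) - fps_act L (F * fps_exp (- of_real a)) v w)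
         \<le> C * powr_err L v w"
proof
  let ?C = "\<Sum>m<L. cmod (fps_nth F m) * (a ^ (L - m) / fact (L - m - 1))"
  show "?C \<ge> 0"
    using assms by (intro sum_nonneg) auto
  fix v w :: complex assume vw: "Re w > 0" "Re v + real L \<ge> 0"
  let ?T = "\<lambda>m. \<Sum>l<L - m. (- of_real a) ^ l / fact l * neg_deriv_powr (m + l) v w"
  let ?g = "\<lambda>m l. fps_nth F m * ((- of_real a) ^ l / fact l * neg_deriv_powr (m + l) v w)"
  have "fps_act L (F * fps_exp (- of_real a)) v w = (\<Sum>n<L. \<Sum>m\<le>n. ?g m (n - m))"
    by (auto simp: fps_act_def fps_mult_nth sum_distrib_right atLeast0AtMost intro!: sum.cong)
  also have "\<dots> = (\<Sum>(m, l)\<in>{(m, l). m + l < L}. ?g m l)"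
    by (rule sum.triangle_reindex[symmetric])
  also have "{(m, l). m + l < L} = Sigma {..<L} (\<lambda>m. {..<L - m})"
    by auto
  also have "(\<Sum>(m, l)\<in>\<dots>. ?g m l) = (\<Sum>m<L. \<Sum>l<L - m. ?g m l)"
    by (rule sum.Sigma[symmetric]) auto
  also have "\<dots> = (\<Sum>m<L. fps_nth F m * ?T m)"
    by (simp add: sum_distrib_left)
  finally have "fps_act L F v (w + of_real a) - fps_act L (F * fps_exp (- of_real a)) v w =
      (\<Sum>m<L. fps_nth F m * (neg_deriv_powr m v (w + of_real a) - ?T m))"
    by (simp add: fps_act_def sum_subtractf algebra_simps)
  also have "cmod \<dots> \<le> (\<Sum>m<L. cmod (fps_nth F m) *
      (a ^ (L - m) / fact (L - m - 1) * powr_err L v w))"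
    unfolding norm_mult using vw assms
    by (intro order_trans[OF sum_norm_le[OF order_refl]] sum_mono)
       (simp only: norm_mult, intro mult_left_mono neg_deriv_powr_Taylor, auto)
  also have "\<dots> = ?C * powr_err L v w"
    by (simp add: sum_distrib_right mult.assoc)
  finally show "cmod (fps_act L F v (w + of_real a) - fps_act L (F * fps_exp (- of_real a)) v w)
      \<le> ?C * powr_err L v w" .
qed

section \<open>Iterated differences in the directions \<open>a 1\<close>, ...,
  \<open>a i\<close>\<close>

fun iter_diff :: "(nat \<Rightarrow> real) \<Rightarrow> nat \<Rightarrow> (complex \<Rightarrow> complex) \<Rightarrow> complex \<Rightarrow> complex" where
  "iter_diff a 0 f w = f w"
| "iter_diff a (Suc i) f w = iter_diff a i f w - iter_diff a i f (w + of_real (a (Suc i)))"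

lemma fps_act_diff: "fps_act L (F - G) v w = fps_act L F v w - fps_act L G v w"
  by (simp add: fps_act_def algebra_simps sum_subtractf)

text \<open>Each new direction multiplies the series by 1 - exp(- b X), with error \<open>D\<close>
  from the shift. The induction hypothesis is used at \<open>w\<close> and at \<open>w + b\<close>,
  and the error at \<open>w + b\<close> is at most that at \<open>w\<close>; hence the constant
  \<open>2 * C + D\<close>.\<close>

lemma iter_diff_fps_act:
  assumes "\<And>j. j \<in> {1..i} \<Longrightarrow> a j > 0"
  obtains C where "C \<ge> 0"
    "\<And>v w. Re w > 0 \<Longrightarrow> Re v + real L \<ge> 0 \<Longrightarrow>
       cmod (iter_diff a i (fps_act L F v) w -
             fps_act L (F * (\<Prod>j=1..i. 1 - fps_exp (- of_real (a j)))) v w)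
         \<le> C * powr_err L v w"
proof -
  have "\<exists>C\<ge>0. \<forall>v w. Re w > 0 \<longrightarrow> Re v + real L \<ge> 0 \<longrightarrow>
       cmod (iter_diff a i (fps_act L F v) w -
             fps_act L (F * (\<Prod>j=1..i. 1 - fps_exp (- of_real (a j)))) v w)
         \<le> C * powr_err L v w"
    using assms
  proof (induction i)
    case 0
    then show ?case by (auto intro!: exI[of _ 0])
  next
    case (Suc i)
    let ?P = "\<lambda>i. F * (\<Prod>j=1..i. 1 - fps_exp (- of_real (a j)) :: complex fps)"
    let ?b = "a (Suc i)"
    have b: "?b > 0"
      using Suc.prems by auto
    obtain C where C: "C \<ge> 0" "\<And>v w. Re w > 0 \<Longrightarrow> Re v + real L \<ge> 0 \<Longrightarrow>
        cmod (iter_diff a i (fps_act L F v) w - fps_act L (?P i) v w) \<le> C * powr_err L v w"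
      using Suc.IH Suc.prems by force
    obtain D where D: "D \<ge> 0" "\<And>v w. Re w > 0 \<Longrightarrow> Re v + real L \<ge> 0 \<Longrightarrow>
       cmod (fps_act L (?P i) v (w + of_real ?b) - fps_act L (?P i * fps_exp (- of_real ?b)) v w)
         \<le> D * powr_err L v w"
      using fps_act_shift[of ?b] b by (metis less_imp_le)
    have "cmod (iter_diff a (Suc i) (fps_act L F v) w - fps_act L (?P (Suc i)) v w)
        \<le> (2 * C + D) * powr_err L v w" if vw: "Re w > 0" "Re v + real L \<ge> 0" for v w
    proof -
      let ?w = "w + of_real ?b"
      let ?x = "iter_diff a i (fps_act L F v) w - fps_act L (?P i) v w"
      let ?y = "iter_diff a i (fps_act L F v) ?w - fps_act L (?P i) v ?w"
      let ?z = "fps_act L (?P i) v ?w - fps_act L (?P i * fps_exp (- of_real ?b)) v w"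
      have "?P (Suc i) = ?P i - ?P i * fps_exp (- of_real ?b)"
        by (simp add: algebra_simps)
      then have "iter_diff a (Suc i) (fps_act L F v) w - fps_act L (?P (Suc i)) v w = ?x - ?y - ?z"
        by (simp add: fps_act_diff)
      then have "cmod (iter_diff a (Suc i) (fps_act L F v) w - fps_act L (?P (Suc i)) v w)
          = cmod (?x - ?y - ?z)"
        by (rule arg_cong)
      also have "\<dots> \<le> cmod ?x + cmod ?y + cmod ?z"
        using norm_triangle_ineq4[of "?x - ?y" ?z] norm_triangle_ineq4[of ?x ?y] by linarith
      also have "\<dots> \<le> C * powr_err L v w + C * powr_err L v w + D * powr_err L v w"
      proof (intro add_mono)
        have "Re ?w > 0"
          using vw b by simp
        then have "cmod ?y \<le> C * powr_err L v ?w"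
          using vw by (intro C(2))
        also have "\<dots> \<le> C * powr_err L v w"
          using vw b C(1) by (intro mult_left_mono powr_err_antimono norm_le_shift) auto
        finally show "cmod ?y \<le> C * powr_err L v w" .
        show "cmod ?x \<le> C * powr_err L v w"
          using vw by (intro C(2))
        show "cmod ?z \<le> D * powr_err L v w"
          using vw by (intro D(2))
      qed
      finally show ?thesis
        by (simp add: algebra_simps)
    qed
    moreover have "2 * C + D \<ge> 0"
      using C D by simp
    ultimately show ?case by blast
  qed
  then show thesis
    using that by blast
qed

subsection \<open>Sums over the lattice\<close>

definition lattice_pt :: "nat \<Rightarrow> (nat \<Rightarrow> real) \<Rightarrow> complex \<Rightarrow> (nat \<Rightarrow> nat) \<Rightarrow> complex" where
  "lattice_pt M a w k = w + (\<Sum>j=1..M. of_nat (k j) * of_real (a j))"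

lemma Re_lattice_pt: "Re (lattice_pt M a w k) = Re w + (\<Sum>j=1..M. real (k j) * a j)"
  by (simp add: lattice_pt_def)

lemma Re_lattice_pt_ge:
  assumes "\<And>j. j \<in> {1..M} \<Longrightarrow> a j > 0"
  shows "Re (lattice_pt M a w k) \<ge> Re w"
  using assms by (auto simp: Re_lattice_pt less_imp_le intro!: sum_nonneg)

text \<open>Splitting the exponent into \<open>M\<close> equal parts \<open>q = p / M > 1\<close>
  bounds the term by a product of one-dimensional convergent series, since the modulus is at least
  \<open>c * (k j + 1)\<close> for every single \<open>j\<close>.\<close>

lemma summable_lattice_powr:
  assumes "\<And>j. j \<in> {1..M} \<Longrightarrow> a j > 0" "Re w > 0" "p > real M"
  shows "(\<lambda>k. cmod (lattice_pt M a w k) powr (- p)) summable_on ({1..M} \<rightarrow>\<^sub>E UNIV)"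
proof (cases "M = 0")
  case True
  then show ?thesis by simp
next
  case False
  \<comment> \<open>Being below \<open>Re w\<close> as well as below all \<open>a j\<close>,
    \<open>c\<close> supplies the summand 1 in \<open>k j + 1\<close>.\<close>
  define c where "c = Min (insert (Re w) (a ` {1..M}))"
  have c: "c > 0" "c \<le> Re w" "\<And>j. j \<in> {1..M} \<Longrightarrow> c \<le> a j"
    using assms by (auto simp: c_def simp del: Min_insert intro!: Min_le)
  define q where "q = p / real M"
  have q: "q > 1"
    using assms False by (simp add: q_def)
  define g where "g n = (c * real (Suc n)) powr (- q)" for n
  have "summable (\<lambda>n. real n powr (- q))"
    using q by (simp add: summable_real_powr_iff)
  then have "summable (\<lambda>n. c powr (- q) * real (Suc n) powr (- q))"
    by (subst (asm) summable_Suc_iff[symmetric]) (intro summable_mult)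
  then have "summable g"
    using c by (simp add: g_def [abs_def] powr_mult)
  then have g: "Infinite_Set_Sum.abs_summable_on g UNIV"
    by (simp add: abs_summable_on_nat_iff' g_def [abs_def])
  have "Infinite_Set_Sum.abs_summable_on (\<lambda>k. \<Prod>j\<in>{1..M}. g (k j)) ({1..M} \<rightarrow>\<^sub>E UNIV)"
    using g by (intro Infinite_Set_Sum.abs_summable_on_prod_PiE) auto
  then have "Infinite_Sum.abs_summable_on (\<lambda>k. \<Prod>j\<in>{1..M}. g (k j)) ({1..M} \<rightarrow>\<^sub>E UNIV)"
    by (simp only: abs_summable_equivalent)
  moreover have "(\<lambda>k. norm (\<Prod>j\<in>{1..M}. g (k j))) = (\<lambda>k. \<Prod>j\<in>{1..M}. g (k j))"
    by (intro ext) (simp add: g_def abs_prod)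
  ultimately have *: "(\<lambda>k. \<Prod>j\<in>{1..M}. g (k j)) summable_on ({1..M} \<rightarrow>\<^sub>E UNIV)"
    by simp
  show ?thesis
  proof (rule summable_on_comparison_test[OF *])
    fix k
    let ?z = "lattice_pt M a w k"
    have z: "c * real (Suc (k j)) \<le> cmod ?z" if j: "j \<in> {1..M}" for j
    proof -
      have "real (k j) * c \<le> real (k j) * a j"
        using c j by (intro mult_left_mono) auto
      also have "\<dots> \<le> (\<Sum>j=1..M. real (k j) * a j)"
        using j assms by (intro member_le_sum) (auto simp: less_imp_le)
      finally have "c * real (Suc (k j)) \<le> Re ?z"
        using c by (simp add: Re_lattice_pt algebra_simps)
      then show ?thesis
        using complex_Re_le_cmod order_trans by blast
    qed
    have "cmod ?z powr (- p) = cmod ?z powr (\<Sum>j\<in>{1..M}. - q)"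
      using False by (simp add: q_def)
    also have "\<dots> = (\<Prod>j\<in>{1..M}. cmod ?z powr (- q))"
    proof (rule powr_sum)
      show "cmod ?z \<noteq> 0"
        using z[of 1] False c(1) by (auto simp: mult_le_0_iff)
    qed
    also have "\<dots> \<le> (\<Prod>j\<in>{1..M}. g (k j))"
      unfolding g_def using z c q by (intro prod_mono conjI powr_mono2') auto
    finally show "cmod ?z powr (- p) \<le> (\<Prod>j\<in>{1..M}. g (k j))" .
  qed auto
qed

lemma abs_summable_lattice:
  assumes "\<And>j. j \<in> {1..M} \<Longrightarrow> a j > 0" "Re w > 0" "p > real M"
    and "\<And>z. Re z \<ge> Re w \<Longrightarrow> cmod (f z) \<le> C * cmod z powr (- p)"
  shows "(\<lambda>k. norm (f (lattice_pt M a w k))) summable_on ({1..M} \<rightarrow>\<^sub>E UNIV)"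
proof (rule Infinite_Sum.abs_summable_on_comparison_test')
  show "(\<lambda>k. C * cmod (lattice_pt M a w k) powr (- p)) summable_on ({1..M} \<rightarrow>\<^sub>E UNIV)"
    by (intro summable_on_cmult_right summable_lattice_powr assms)
qed (use assms Re_lattice_pt_ge in auto)

lemma lattice_pt_insert:
  "lattice_pt (Suc i) a w (k(Suc i := n)) = lattice_pt i a w k + of_nat n * of_real (a (Suc i))"
proof -
  have "(\<Sum>j=1..i. of_nat ((k(Suc i := n)) j) * complex_of_real (a j)) =
      (\<Sum>j=1..i. of_nat (k j) * of_real (a j))"
    by (intro sum.cong) auto
  then show ?thesis
    by (simp add: lattice_pt_def)
qed

lemma bij_betw_PiE_Suc:
  "bij_betw (\<lambda>(k, n). k(Suc i := n)) (({1..i} \<rightarrow>\<^sub>E (UNIV :: nat set)) \<times> UNIV) ({1..Suc i} \<rightarrow>\<^sub>E UNIV)"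
\<comment> \<open>Members of \<open>PiE\<close> are \<open>undefined\<close> outside the index set,
  so the inverse has to reset the removed coordinate.\<close>
proof (rule bij_betwI[where g = "\<lambda>k. (k(Suc i := undefined), k (Suc i))"])
  show "(\<lambda>(k, n). k(Suc i := n)) \<in> ({1..i} \<rightarrow>\<^sub>E (UNIV :: nat set)) \<times> UNIV \<rightarrow> {1..Suc i} \<rightarrow>\<^sub>E UNIV"
    by (auto simp: PiE_iff extensional_def)
  show "(\<lambda>k. (k(Suc i := undefined), k (Suc i))) \<in>
      ({1..Suc i} \<rightarrow>\<^sub>E UNIV) \<rightarrow> ({1..i} \<rightarrow>\<^sub>E (UNIV :: nat set)) \<times> UNIV"
    by (auto simp: PiE_iff extensional_def)
qed (auto simp: PiE_iff extensional_def fun_eq_iff)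

text \<open>Summation over the last coordinate telescopes, with boundary term 0 at infinity, and
  lowers the order of the difference and the dimension of the lattice by one. Absolute summability
  at every level justifies the iterated summation.\<close>

lemma iter_diff_has_sum:
  assumes "\<And>j. j \<in> {1..i} \<Longrightarrow> a j > 0" "Re w > 0"
    and summ: "\<And>j. j \<le> i \<Longrightarrow>
      (\<lambda>k. norm (iter_diff a j f (lattice_pt j a w k))) summable_on ({1..j} \<rightarrow>\<^sub>E UNIV)"
    and lim: "\<And>j z. j < i \<Longrightarrow> Re z > 0 \<Longrightarrow>
      (\<lambda>n. iter_diff a j f (z + of_nat n * of_real (a (Suc j)))) \<longlonglongrightarrow> 0"
  shows "((\<lambda>k. iter_diff a i f (lattice_pt i a w k)) has_sum f w) ({1..i} \<rightarrow>\<^sub>E UNIV)"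
  using assms
proof (induction i)
  case 0
  then show ?case
    by (simp add: lattice_pt_def has_sum_finite_iff)
next
  case (Suc i)
  let ?A = "{1..i} \<rightarrow>\<^sub>E (UNIV :: nat set)" and ?b = "a (Suc i)"
  let ?g = "\<lambda>(k, n). iter_diff a (Suc i) f (lattice_pt i a w k + of_nat n * of_real ?b)"
  have conv: "(\<lambda>x. iter_diff a (Suc i) f (lattice_pt (Suc i) a w ((\<lambda>(k, n). k(Suc i := n)) x))) = ?g"
    by (auto simp: lattice_pt_insert fun_eq_iff simp del: iter_diff.simps)
  have "(\<lambda>k. norm (iter_diff a (Suc i) f (lattice_pt (Suc i) a w k)))
      summable_on ({1..Suc i} \<rightarrow>\<^sub>E UNIV)"
    using Suc.prems(3)[of "Suc i"] by (simp del: iter_diff.simps)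
  then have g: "(\<lambda>x. norm (?g x)) summable_on (?A \<times> UNIV)"
    using summable_on_reindex_bij_betw[OF bij_betw_PiE_Suc[of i],
        of "\<lambda>k. norm (iter_diff a (Suc i) f (lattice_pt (Suc i) a w k))"]
    by (simp add: case_prod_unfold lattice_pt_insert del: iter_diff.simps)
  have inner: "((\<lambda>n. ?g (k, n)) has_sum iter_diff a i f (lattice_pt i a w k)) UNIV" if "k \<in> ?A" for k
  proof -
    let ?z = "lattice_pt i a w k"
    let ?h = "\<lambda>n. iter_diff a i f (?z + of_nat n * of_real ?b)"
    have "?h \<longlonglongrightarrow> 0"
      using Suc.prems(1,2) Re_lattice_pt_ge[of i a w k] by (intro Suc.prems(4)) force+
    then have "(\<lambda>n. ?h n - ?h (Suc n)) sums (?h 0 - 0)"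
      by (rule telescope_sums')
    moreover have "?h n - ?h (Suc n) = ?g (k, n)" for n
      by (simp add: algebra_simps)
    ultimately have "(\<lambda>n. ?g (k, n)) sums ?h 0"
      by simp
    moreover have "summable (\<lambda>n. norm (?g (k, n)))"
    proof -
      have "(\<lambda>n. norm (?g (k, n))) summable_on UNIV"
        using summable_on_SigmaD1[where f = "\<lambda>k n. norm (?g (k, n))" and x = k] g that
        by (simp add: case_prod_unfold del: iter_diff.simps)
      then show ?thesis
        by (rule summable_on_imp_summable)
    qed
    ultimately show ?thesis
      using norm_summable_imp_has_sum by fastforce
  qed
  have "((\<lambda>k. iter_diff a i f (lattice_pt i a w k)) has_sum f w) ?A"
    using Suc.prems by (intro Suc.IH) auto
  \<comment> \<open>Absolute convergence provides some value for the double sum; summing it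
    iteratedly identifies this value with the one from the induction hypothesis.\<close>
  moreover have "(?g has_sum infsum ?g (?A \<times> UNIV)) (?A \<times> UNIV)"
    using g abs_summable_summable by (intro has_sum_infsum) blast
  then have "((\<lambda>k. iter_diff a i f (lattice_pt i a w k)) has_sum infsum ?g (?A \<times> UNIV)) ?A"
    using inner by (rule has_sum_SigmaD)
  ultimately have "infsum ?g (?A \<times> UNIV) = f w"
    using has_sum_unique by blast
  with \<open>(?g has_sum infsum ?g (?A \<times> UNIV)) (?A \<times> UNIV)\<close> have "(?g has_sum f w) (?A \<times> UNIV)"
    by simp
  then show ?case
    using has_sum_reindex_bij_betw[OF bij_betw_PiE_Suc[of i],
        of "\<lambda>k. iter_diff a (Suc i) f (lattice_pt (Suc i) a w k)" "f w"]
    unfolding conv by simp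
qed

text \<open>The Weierstrass M-test on small closed discs gives local uniform convergence along the
  filter of finite subsets, and uniform limits of holomorphic functions are holomorphic.\<close>

lemma holomorphic_on_infsum:
  fixes f :: "'a \<Rightarrow> complex \<Rightarrow> complex"
  assumes "open S" and holo: "\<And>x. x \<in> X \<Longrightarrow> f x holomorphic_on S"
    and bound: "\<And>z. z \<in> S \<Longrightarrow> \<exists>r>0. \<exists>B. cball z r \<subseteq> S \<and> B summable_on X \<and>
                  (\<forall>x\<in>X. \<forall>y\<in>cball z r. cmod (f x y) \<le> B x)"
  shows "(\<lambda>z. \<Sum>\<^sub>\<infinity>x\<in>X. f x z) holomorphic_on S"
proof -
  have "(\<lambda>z. \<Sum>\<^sub>\<infinity>x\<in>X. f x z) field_differentiable at z" if z: "z \<in> S" for z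
  proof -
    obtain r B where r: "r > 0" "cball z r \<subseteq> S" "B summable_on X"
      "\<And>x y. x \<in> X \<Longrightarrow> y \<in> cball z r \<Longrightarrow> cmod (f x y) \<le> B x"
      using bound[OF z] by blast
    have ul: "uniform_limit (cball z r) (\<lambda>X y. \<Sum>x\<in>X. f x y) (\<lambda>y. \<Sum>\<^sub>\<infinity>x\<in>X. f x y)
        (finite_subsets_at_top X)"
      using r by (intro Weierstrass_m_test_general)
    have ev: "\<forall>\<^sub>F Y in finite_subsets_at_top X. continuous_on (cball z r) (\<lambda>y. \<Sum>x\<in>Y. f x y) \<and>
        (\<lambda>y. \<Sum>x\<in>Y. f x y) holomorphic_on ball z r"
    proof (rule eventually_finite_subsets_at_top_weakI)
      fix Y assume Y: "finite Y" "Y \<subseteq> X"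
      then have "(\<lambda>y. \<Sum>x\<in>Y. f x y) holomorphic_on S"
        using holo by (intro holomorphic_intros) auto
      then show "continuous_on (cball z r) (\<lambda>y. \<Sum>x\<in>Y. f x y) \<and>
        (\<lambda>y. \<Sum>x\<in>Y. f x y) holomorphic_on ball z r"
        using r ball_subset_cball[of z r]
        by (meson continuous_on_subset holomorphic_on_imp_continuous_on holomorphic_on_subset order_trans)
    qed
    have "(\<lambda>y. \<Sum>\<^sub>\<infinity>x\<in>X. f x y) holomorphic_on ball z r"
      by (rule holomorphic_uniform_limit[OF ev ul]) auto
    then show ?thesis
      using r(1) by (simp add: holomorphic_on_imp_differentiable_at)
  qed
  then show ?thesis
    by (simp add: field_differentiable_at_within holomorphic_on_def)
qed

lemma powr_minus_le_of_ge:
  fixes x r p q :: real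
  assumes "0 < r" "r \<le> x" "p \<le> q"
  shows "x powr - q \<le> r powr - (q - p) * x powr - p"
proof -
  have "x powr - q = x powr - (q - p) * x powr - p"
    by (simp flip: powr_add)
  also have "\<dots> \<le> r powr - (q - p) * x powr - p"
    using assms by (intro mult_right_mono powr_mono2') auto
  finally show ?thesis .
qed

text \<open>Replaces the exponent \<open>Re v + m\<close> by a smaller one \<open>p\<close>, which
  can be common to all \<open>m\<close> in a sum or to all \<open>v\<close> in a disc; staying at
  distance \<open>r\<close> from 0 pays for this with a constant.\<close>

lemma powr_err_le:
  assumes "0 < r" "r \<le> cmod z" "p \<le> Re v + real m"
  shows "powr_err m v z \<le> cmod (pochhammer v m) * exp (pi * \<bar>Im v\<bar>) *
           r powr - (Re v + real m - p) * cmod z powr - p"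
  using powr_minus_le_of_ge[OF assms]
  by (auto simp: powr_err_def mult.assoc intro!: mult_left_mono)

lemma iter_diff_holomorphic:
  assumes "\<And>z. (\<lambda>v. f v z) holomorphic_on S"
  shows "(\<lambda>v. iter_diff a i (f v) z) holomorphic_on S"
  using assms by (induction i arbitrary: z) (auto intro!: holomorphic_intros)

lemma pochhammer_holomorphic: "(\<lambda>v. pochhammer v n) holomorphic_on (S :: complex set)"
  unfolding pochhammer_prod by (intro holomorphic_intros)

lemma neg_deriv_powr_holomorphic: "(\<lambda>v. neg_deriv_powr m v z) holomorphic_on S"
  unfolding neg_deriv_powr_def by (intro holomorphic_intros pochhammer_holomorphic)

lemma fps_act_holomorphic: "(\<lambda>v. fps_act L F v z) holomorphic_on S"
  unfolding fps_act_def by (intro holomorphic_intros neg_deriv_powr_holomorphic)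

lemma halfplane_Re_gt:
  "open {v. Re v > c}" "convex {v. Re v > c}"
  using open_halfspace_Re_gt convex_halfspace_Re_gt by auto

text \<open>Used at \<open>s = 0\<close>: the values with \<open>m > n\<close> vanish, which kills
  the remainders, and the one with \<open>m = n\<close> does not, so the denominator of the
  continued zeta function is nonzero there.\<close>

lemma pochhammer_minus_of_nat:
  "pochhammer (- of_nat n) m = ((-1) ^ m * fact m * of_nat (n choose m) :: complex)"
proof -
  have "of_nat (n choose m) = ((-1) ^ m * pochhammer (- of_nat n) m / fact m :: complex)"
    by (simp add: binomial_gbinomial gbinomial_pochhammer)
  then have "(-1) ^ m * fact m * of_nat (n choose m) =
      ((-1) ^ m * (-1) ^ m) * (pochhammer (- of_nat n) m :: complex)"
    by simp
  also have "(-1) ^ m * (-1) ^ m = (1 :: complex)"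
    by (simp flip: power_add mult_2)
  finally show ?thesis by simp
qed

subsection \<open>Meromorphic functions agreeing on a half-plane\<close>

text \<open>The identity theorem, applied to the difference after its singularities are removed.
  Merely meromorphic functions may take arbitrary values at isolated points, hence equality only on
  punctured neighbourhoods.\<close>

lemma meromorphic_eq_halfplane_imp_eq:
  assumes "f meromorphic_on UNIV" "g meromorphic_on UNIV" "\<And>s. Re s > c \<Longrightarrow> f s = g s"
  shows "eventually (\<lambda>s. f s = g s) (at z)"
proof -
  have mero: "(\<lambda>s. f s - g s) meromorphic_on UNIV"
    using assms by (intro meromorphic_intros)
  define h where "h = remove_sings (\<lambda>s. f s - g s)"
  let ?s = "of_real (c + 1) :: complex"
  have "h s = 0" if "Re s > c" for s
  proof -
    have "eventually (\<lambda>s. s \<in> {s. Re s > c}) (at s)"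
      using that halfplane_Re_gt(1)[of c] by (intro eventually_at_in_open') auto
    then have "eventually (\<lambda>s. f s - g s = 0) (at s)"
      by eventually_elim (simp add: assms)
    then have "h s = remove_sings (\<lambda>_. 0) s"
      unfolding h_def by (rule remove_sings_cong) simp
    then show ?thesis
      by (simp add: remove_sings_at_analytic)
  qed
  then have "eventually (\<lambda>s. h s = 0) (at ?s)"
    using eventually_at_in_open'[of "{s. Re s > c}" ?s] halfplane_Re_gt(1)[of c]
    by (auto elim!: eventually_mono)
  then have "frequently (\<lambda>s. h s = 0) (at ?s)"
    by (intro eventually_frequently) auto
  moreover have "h nicely_meromorphic_on UNIV"
    unfolding h_def by (intro remove_sings_nicely_meromorphic mero)
  ultimately have h0: "h s = 0" for s
    using frequently_eq_meromorphic_imp_constant[of h 0 ?s UNIV s] by auto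
  have "isolated_singularity_at (\<lambda>s. f s - g s) z"
    using mero by (meson UNIV_I meromorphic_on_isolated_singularity meromorphic_on_subset subset_UNIV)
  then have "eventually (\<lambda>s. h s = f s - g s) (at z)"
    unfolding h_def by (rule eventually_remove_sings_eq_at)
  then show ?thesis
    by eventually_elim (simp add: h0)
qed

text \<open>A nicely meromorphic function is fixed by \<open>remove_sings\<close>, so its punctured
  germ at \<open>z\<close> determines its value at \<open>z\<close>.\<close>

lemma nicely_meromorphic_eqI:
  assumes f: "f nicely_meromorphic_on UNIV" and g: "g nicely_meromorphic_on UNIV"
    and "\<And>s. Re s > c \<Longrightarrow> f s = g s"
  shows "f = g"
proof
  fix z
  have ev: "eventually (\<lambda>s. f s = g s) (at z)"
    using assms by (intro meromorphic_eq_halfplane_imp_eq) (auto simp: nicely_meromorphic_on_def)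
  have "remove_sings F z = F z" if "F nicely_meromorphic_on UNIV" for F
    using that unfolding nicely_meromorphic_on_def
    by (metis UNIV_I remove_sings_at_pole remove_sings_eqI)
  then show "f z = g z"
    using f g remove_sings_cong[OF ev refl] by metis
qed

subsection \<open>The continuation of the Barnes zeta function\<close>

locale barnes_parameters =
  fixes M :: nat and a :: "nat \<Rightarrow> real" and w :: complex
  assumes a_pos: "\<And>j. j \<in> {1..M} \<Longrightarrow> a j > 0" and w_pos: "Re w > 0"
begin

section \<open>The Bernoulli power series and the decay of its differences\<close>

definition denom_fps :: "nat \<Rightarrow> complex fps" where
  "denom_fps i = (\<Prod>j=1..i. 1 - fps_exp (- of_real (a j)))"

text \<open>Generating series of the multiple Bernoulli polynomials at \<open>x = 0\<close>.
  Division of power series drops negative powers in general; here it is exact by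
  \<open>denom_fps_dvd\<close>.\<close>

definition bernoulli_fps :: "complex fps" where
  "bernoulli_fps = fps_X ^ M / denom_fps M"

lemma one_minus_exp:
  assumes "j \<in> {1..M}"
  shows "subdegree (1 - fps_exp (- complex_of_real (a j))) = 1" 
    "1 - fps_exp (- complex_of_real (a j)) \<noteq> 0"
proof -
  have *: "fps_nth (1 - fps_exp (- complex_of_real (a j))) 1 \<noteq> 0"
    using a_pos[OF assms] by simp
  then show "subdegree (1 - fps_exp (- complex_of_real (a j))) = 1"
    by (intro subdegreeI) auto
  from * show "1 - fps_exp (- complex_of_real (a j)) \<noteq> 0"
    by (metis fps_zero_nth)
qed

lemma denom_fps_nonzero: "i \<le> M \<Longrightarrow> denom_fps i \<noteq> 0"
  using one_minus_exp(2) by (auto simp: denom_fps_def simp del: One_nat_def)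

lemma subdegree_denom_fps:
  assumes "i \<le> M"
  shows "subdegree (denom_fps i) = i"
proof -
  have "subdegree (denom_fps i) = (\<Sum>j=1..i. subdegree (1 - fps_exp (- complex_of_real (a j))))"
    unfolding denom_fps_def using assms by (intro subdegree_prod one_minus_exp(2)) auto
  also have "\<dots> = (\<Sum>j=1..i. 1)"
    using assms by (intro sum.cong refl one_minus_exp(1)) auto
  finally show ?thesis by simp
qed

lemma denom_fps_dvd: "denom_fps M dvd fps_X ^ M"
  using denom_fps_nonzero[of M] subdegree_denom_fps[of M] by (subst fps_dvd_iff) (auto simp: fps_X_power_subdegree)

lemma bernoulli_fps_mult_denom_fps: "bernoulli_fps * denom_fps M = fps_X ^ M"
  using denom_fps_dvd by (simp add: bernoulli_fps_def)

lemma bernoulli_fps_mult_denom_fps_nth: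
  assumes "i \<le> M" "m < i"
  shows "fps_nth (bernoulli_fps * denom_fps i) m = 0"
  using assms subdegree_denom_fps[of i] nth_less_subdegree_zero[of m "bernoulli_fps * denom_fps i"]
  by (cases "bernoulli_fps = 0") (auto simp: denom_fps_nonzero)

text \<open>Every difference gains one power of decay: after \<open>i\<close> of them the series
  starts at X^i, and the remainder has order \<open>L \<ge> i\<close>. The resulting exponent
  \<open>Re v + i\<close> exceeds the dimension \<open>i\<close>, as summation over the
  \<open>i\<close>-dimensional lattice requires.\<close>

lemma partial_diff_bound:
  assumes "i \<le> M" "M \<le> L" "Re v > 0" "r > 0"
  obtains C where "\<And>z. Re z \<ge> r \<Longrightarrow>
    cmod (iter_diff a i (fps_act L bernoulli_fps v) z) \<le> C * cmod z powr - (Re v + real i)"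
proof -
  let ?p = "Re v + real i"
  define K where "K m = cmod (pochhammer v m) * exp (pi * \<bar>Im v\<bar>) * r powr - (Re v + real m - ?p)" for m
  have K: "powr_err m v z \<le> K m * cmod z powr - ?p" if "Re z \<ge> r" "m \<ge> i" for z m
    unfolding K_def using that complex_Re_le_cmod[of z] assms by (intro powr_err_le) auto
  obtain C where C: "C \<ge> 0" "\<And>v w. Re w > 0 \<Longrightarrow> Re v + real L \<ge> 0 \<Longrightarrow>
     cmod (iter_diff a i (fps_act L bernoulli_fps v) w -
           fps_act L (bernoulli_fps * denom_fps i) v w) \<le> C * powr_err L v w"
    unfolding denom_fps_def using assms a_pos by (elim iter_diff_fps_act[rotated]) auto
  let ?D = "C * K L + (\<Sum>m<L. cmod (fps_nth (bernoulli_fps * denom_fps i) m) * K m)"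
  show thesis
  proof (rule that)
    fix z assume z: "Re z \<ge> r"
    have "cmod (fps_act L (bernoulli_fps * denom_fps i) v z) \<le>
        (\<Sum>m<L. cmod (fps_nth (bernoulli_fps * denom_fps i) m) * (K m * cmod z powr - ?p))"
      unfolding fps_act_def
    proof (rule sum_norm_le)
      fix m
      show "cmod (fps_nth (bernoulli_fps * denom_fps i) m * neg_deriv_powr m v z) \<le>
          cmod (fps_nth (bernoulli_fps * denom_fps i) m) * (K m * cmod z powr - ?p)"
      proof (cases "m < i")
        case True
        then show ?thesis
          using bernoulli_fps_mult_denom_fps_nth[OF assms(1)] by simp
      next
        case False
        then have "cmod (neg_deriv_powr m v z) \<le> K m * cmod z powr - ?p"
          using norm_neg_deriv_powr_le[of m v z] K[OF z, of m] by linarith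
        then show ?thesis
          by (simp add: norm_mult mult_left_mono)
      qed
    qed
    moreover have "cmod (iter_diff a i (fps_act L bernoulli_fps v) z - fps_act L (bernoulli_fps * denom_fps i) v z)
        \<le> C * powr_err L v z"
      using z assms by (intro C) auto
    moreover have "C * powr_err L v z \<le> C * (K L * cmod z powr - ?p)"
      using z C assms by (intro mult_left_mono K) auto
    ultimately have "cmod (iter_diff a i (fps_act L bernoulli_fps v) z) \<le> C * (K L * cmod z powr - ?p) +
        (\<Sum>m<L. cmod (fps_nth (bernoulli_fps * denom_fps i) m) * (K m * cmod z powr - ?p))"
      using norm_triangle_sub[of "iter_diff a i (fps_act L bernoulli_fps v) z"
          "fps_act L (bernoulli_fps * denom_fps i) v z"]
      by linarith
    then show "cmod (iter_diff a i (fps_act L bernoulli_fps v) z) \<le> ?D * cmod z powr - ?p"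
      by (simp add: distrib_right sum_distrib_right mult.assoc)
  qed
qed

abbreviation lattice :: "(nat \<Rightarrow> nat) set" where
  "lattice \<equiv> {1..M} \<rightarrow>\<^sub>E UNIV"

lemma partial_diff_has_sum:
  assumes "M \<le> L" "Re v > 0"
  shows "((\<lambda>k. iter_diff a M (fps_act L bernoulli_fps v) (lattice_pt M a w k)) has_sum fps_act L bernoulli_fps v w) lattice"
proof (rule iter_diff_has_sum)
  fix j assume "j \<le> M"
  obtain C where C: "\<And>z. Re z \<ge> Re w \<Longrightarrow>
      cmod (iter_diff a j (fps_act L bernoulli_fps v) z) \<le> C * cmod z powr - (Re v + real j)"
    using partial_diff_bound[OF \<open>j \<le> M\<close> assms w_pos] by blast
  show "(\<lambda>k. norm (iter_diff a j (fps_act L bernoulli_fps v) (lattice_pt j a w k))) summable_on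
      ({1..j} \<rightarrow>\<^sub>E UNIV)"
    using a_pos \<open>j \<le> M\<close> w_pos assms C by (intro abs_summable_lattice[where p = "Re v + real j" and C = C]) auto
next
  fix j z assume j: "j < M" and z: "Re z > 0"
  obtain C where C: "\<And>y. Re y \<ge> Re z \<Longrightarrow>
      cmod (iter_diff a j (fps_act L bernoulli_fps v) y) \<le> C * cmod y powr - (Re v + real j)"
    using partial_diff_bound[OF _ assms z, of j] j by auto
  have a: "a (Suc j) > 0"
    using a_pos j by simp
  let ?y = "\<lambda>n. z + of_nat n * complex_of_real (a (Suc j))"
  have lim: "filterlim (\<lambda>n. real n * a (Suc j)) at_top sequentially"
    using a by (intro filterlim_at_top_mult_tendsto_pos[OF tendsto_const] filterlim_real_sequentially)
  have le: "real n * a (Suc j) \<le> cmod (?y n)" for n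
    using complex_Re_le_cmod[of "?y n"] z by simp
  have "filterlim (\<lambda>n. cmod (?y n)) at_top sequentially"
    by (rule filterlim_at_top_mono[OF lim]) (simp add: le)
  then have "(\<lambda>n. cmod (?y n) powr - (Re v + real j)) \<longlonglongrightarrow> 0"
    using assms by (intro tendsto_neg_powr) auto
  then have "(\<lambda>n. C * cmod (?y n) powr - (Re v + real j)) \<longlonglongrightarrow> 0"
    by (rule tendsto_mult_right_zero)
  then show "(\<lambda>n. iter_diff a j (fps_act L bernoulli_fps v) (?y n)) \<longlonglongrightarrow> 0"
  proof (rule Lim_null_comparison[rotated], intro always_eventually allI)
    fix n
    show "norm (iter_diff a j (fps_act L bernoulli_fps v) (?y n)) \<le> C * cmod (?y n) powr - (Re v + real j)"
      using a by (intro C) simp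
  qed
qed (use a_pos w_pos in auto)

definition defect :: "nat \<Rightarrow> complex \<Rightarrow> complex \<Rightarrow> complex" where
  "defect L v z = neg_deriv_powr M v z - iter_diff a M (fps_act L bernoulli_fps v) z"

text \<open>For \<open>M < L\<close> the truncation keeps the only term of X^M =
  \<open>bernoulli_fps * denom_fps M\<close>, which acts as \<open>neg_deriv_powr M\<close>. So the
  defect is just the error in \<open>iter_diff_fps_act\<close>.\<close>

lemma defect_bound:
  assumes "M < L"
  obtains C where "C \<ge> 0"
    "\<And>v z. Re z > 0 \<Longrightarrow> Re v + real L \<ge> 0 \<Longrightarrow> cmod (defect L v z) \<le> C * powr_err L v z"
proof -
  obtain C where C: "C \<ge> 0" "\<And>v w. Re w > 0 \<Longrightarrow> Re v + real L \<ge> 0 \<Longrightarrow>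
     cmod (iter_diff a M (fps_act L bernoulli_fps v) w -
           fps_act L (bernoulli_fps * denom_fps M) v w) \<le> C * powr_err L v w"
    unfolding denom_fps_def using a_pos by (elim iter_diff_fps_act[rotated]) auto
  have "fps_act L (bernoulli_fps * denom_fps M) v z = (\<Sum>m<L. if m = M then neg_deriv_powr m v z else 0)" for v z
    unfolding bernoulli_fps_mult_denom_fps fps_act_def by (intro sum.cong) auto
  then have "fps_act L (bernoulli_fps * denom_fps M) v z = neg_deriv_powr M v z" for v z
    using assms by simp
  then show thesis
    using that[of C] C by (simp add: defect_def norm_minus_commute)
qed

lemma defect_locally_bounded:
  assumes "M < L" "Re v0 > real M - real L"
  obtains r B where "r > 0" "cball v0 r \<subseteq> {v. Re v > real M - real L}" "B summable_on lattice"
    "\<And>k v. v \<in> cball v0 r \<Longrightarrow> cmod (defect L v (lattice_pt M a w k)) \<le> B k"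
proof -
  \<comment> \<open>Half the distance from \<open>v0\<close> to the boundary line; then
    \<open>p\<close>, the least value of \<open>Re v + L\<close> on the disc, still exceeds
    \<open>M\<close>.\<close>
  define r where "r = (Re v0 + real L - real M) / 2"
  define p where "p = Re v0 + real L - r"
  have r: "r > 0" "p > real M"
    using assms by (auto simp: r_def p_def field_simps)
  have p: "p \<le> Re v + real L" if "v \<in> cball v0 r" for v
    using that abs_Re_le_cmod[of "v0 - v"] by (auto simp: p_def dist_norm)
  obtain C where C: "C \<ge> 0"
    "\<And>v z. Re z > 0 \<Longrightarrow> Re v + real L \<ge> 0 \<Longrightarrow> cmod (defect L v z) \<le> C * powr_err L v z"
    using defect_bound[OF assms(1)] by blast
  define K where "K v = cmod (pochhammer v L) * exp (pi * \<bar>Im v\<bar>) * Re w powr - (Re v + real L - p)" for v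
  have "continuous_on (cball v0 r) K"
    unfolding K_def using w_pos
    by (intro continuous_intros holomorphic_on_imp_continuous_on pochhammer_holomorphic) auto
  then have "bounded (K ` cball v0 r)"
    by (intro compact_imp_bounded compact_continuous_image) auto
  then obtain D where D: "\<And>v. v \<in> cball v0 r \<Longrightarrow> \<bar>K v\<bar> \<le> D"
    unfolding bounded_iff by (metis image_eqI real_norm_def)
  show thesis
  proof (rule that[of r])
    show "cball v0 r \<subseteq> {v. Re v > real M - real L}"
      using p r by fastforce
    show "(\<lambda>k. C * (D * cmod (lattice_pt M a w k) powr - p)) summable_on lattice"
      using a_pos w_pos r by (intro summable_on_cmult_right summable_lattice_powr) auto
    fix k v assume v: "v \<in> cball v0 r"
    let ?z = "lattice_pt M a w k"
    have z: "Re ?z \<ge> Re w"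
      using a_pos by (rule Re_lattice_pt_ge)
    have "cmod (defect L v ?z) \<le> C * powr_err L v ?z"
      using z w_pos p[OF v] r by (intro C) auto
    also have "\<dots> \<le> C * (K v * cmod ?z powr - p)"
      unfolding K_def using C w_pos z complex_Re_le_cmod[of ?z] p[OF v]
      by (intro mult_left_mono powr_err_le) auto
    also have "\<dots> \<le> C * (D * cmod ?z powr - p)"
      using D[OF v] C by (intro mult_left_mono mult_right_mono) auto
    finally show "cmod (defect L v ?z) \<le> C * (D * cmod ?z powr - p)" .
  qed (use r in auto)
qed

section \<open>Continuation in \<open>v\<close> of the lattice sum of
  \<open>neg_deriv_powr M\<close>\<close>

definition numerator_approx :: "nat \<Rightarrow> complex \<Rightarrow> complex" where
  "numerator_approx L v = fps_act L bernoulli_fps v w + (\<Sum>\<^sub>\<infinity>k\<in>lattice. defect L v (lattice_pt M a w k))"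

lemma numerator_approx_holomorphic:
  assumes "M < L"
  shows "numerator_approx L holomorphic_on {v. Re v > real M - real L}"
proof -
  have "(\<lambda>v. \<Sum>\<^sub>\<infinity>k\<in>lattice. defect L v (lattice_pt M a w k)) holomorphic_on {v. Re v > real M - real L}"
  proof (rule holomorphic_on_infsum)
    fix v assume "v \<in> {v. Re v > real M - real L}"
    then have "Re v > real M - real L"
      by simp
    then obtain r B where "r > 0" "cball v r \<subseteq> {v. Re v > real M - real L}" "B summable_on lattice"
      "\<And>k y. y \<in> cball v r \<Longrightarrow> cmod (defect L y (lattice_pt M a w k)) \<le> B k"
      by (rule defect_locally_bounded[OF assms]) (rule that)
    then show "\<exists>r>0. \<exists>B. cball v r \<subseteq> {v. Re v > real M - real L} \<and> B summable_on lattice \<and>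
        (\<forall>k\<in>lattice. \<forall>y\<in>cball v r. cmod (defect L y (lattice_pt M a w k)) \<le> B k)"
      by (intro exI[of _ r] exI[of _ B] conjI ballI)
  qed (auto simp: defect_def halfplane_Re_gt intro!: holomorphic_intros neg_deriv_powr_holomorphic
         iter_diff_holomorphic fps_act_holomorphic)
  then show ?thesis
    unfolding numerator_approx_def [abs_def] by (intro holomorphic_intros fps_act_holomorphic)
qed

text \<open>Termwise, \<open>neg_deriv_powr M\<close> is iterated difference plus defect. For
  \<open>Re v > 0\<close> the differences sum to the single term
  \<open>fps_act L bernoulli_fps v w\<close>.\<close>

lemma numerator_approx_eq_series:
  assumes "M < L" "Re v > 0"
  shows "numerator_approx L v = (\<Sum>\<^sub>\<infinity>k\<in>lattice. neg_deriv_powr M v (lattice_pt M a w k))"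
proof -
  have "Re v > real M - real L"
    using assms by simp
  then obtain r B where "r > 0" "cball v r \<subseteq> {v. Re v > real M - real L}"
    and B: "B summable_on lattice"
      "\<And>k y. y \<in> cball v r \<Longrightarrow> cmod (defect L y (lattice_pt M a w k)) \<le> B k"
    by (rule defect_locally_bounded[OF assms(1)]) (rule that)
  then have "(\<lambda>k. norm (defect L v (lattice_pt M a w k))) summable_on lattice"
    by (intro Infinite_Sum.abs_summable_on_comparison_test'[OF B(1)]) auto
  then have "((\<lambda>k. defect L v (lattice_pt M a w k)) has_sum (\<Sum>\<^sub>\<infinity>k\<in>lattice. defect L v (lattice_pt M a w k))) lattice"
    by (rule has_sum_infsum[OF abs_summable_summable])
  from has_sum_add[OF partial_diff_has_sum[OF _ assms(2), of L] this] assms(1)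
  have "((\<lambda>k. neg_deriv_powr M v (lattice_pt M a w k)) has_sum numerator_approx L v) lattice"
    by (simp add: defect_def numerator_approx_def)
  then show ?thesis
    by (simp add: infsumI)
qed

text \<open>Both sides equal the same series for \<open>Re v > 0\<close>, a nonempty open part of
  the common half-plane \<open>Re v > c\<close> because \<open>c < 0\<close>.\<close>

lemma numerator_approx_unique:
  assumes "M < L" "M < L'" "Re v > real M - real L" "Re v > real M - real L'"
  shows "numerator_approx L v = numerator_approx L' v"
proof -
  define c where "c = max (real M - real L) (real M - real L')"
  have c: "c < 0"
    using assms by (simp add: c_def)
  show ?thesis
  proof (rule analytic_continuation_open[of "{v. Re v > 0}" "{v. Re v > c}"
        "numerator_approx L" "numerator_approx L'"])
    show "{v. Re v > 0} \<noteq> {}"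
      by (auto intro!: exI[of _ 1])
    show "numerator_approx L holomorphic_on {v. Re v > c}"
      by (rule holomorphic_on_subset[OF numerator_approx_holomorphic]) (use assms in \<open>auto simp: c_def\<close>)
    show "numerator_approx L' holomorphic_on {v. Re v > c}"
      by (rule holomorphic_on_subset[OF numerator_approx_holomorphic]) (use assms in \<open>auto simp: c_def\<close>)
    show "connected {v. Re v > c}"
      by (intro convex_connected halfplane_Re_gt)
    show "v \<in> {v. Re v > c}"
      using assms by (simp add: c_def)
  qed (use assms c in \<open>auto simp: numerator_approx_eq_series halfplane_Re_gt\<close>)
qed

text \<open>The truncation order varies with \<open>v\<close>; the successor ensures both
  \<open>M < L\<close> and the strict inequality \<open>Re v > M - L\<close>.\<close>

definition numerator :: "complex \<Rightarrow> complex" where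
  "numerator v = numerator_approx (Suc (M + nat \<lceil>real M - Re v\<rceil>)) v"

lemma numerator_eq_numerator_approx:
  assumes "M < L" "Re v > real M - real L"
  shows "numerator v = numerator_approx L v"
  unfolding numerator_def
proof (rule numerator_approx_unique)
  show "Re v > real M - real (Suc (M + nat \<lceil>real M - Re v\<rceil>))"
    using of_nat_ceiling[of "real M - Re v"] by simp
qed (use assms in auto)

lemma numerator_holomorphic: "numerator holomorphic_on UNIV"
proof -
  have "numerator holomorphic_on {v. Re v > real M - real L}" if "M < L" for L
    by (rule holomorphic_transform[OF numerator_approx_holomorphic[OF that]])
      (simp add: numerator_eq_numerator_approx[OF that])
  then have "numerator holomorphic_on (\<Union>L\<in>{M<..}. {v. Re v > real M - real L})"
    by (intro holomorphic_on_UN_open) (auto simp: halfplane_Re_gt)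
  moreover have "v \<in> (\<Union>L\<in>{M<..}. {v. Re v > real M - real L})" for v
    using of_nat_ceiling[of "real M - Re v"]
    by (auto intro!: bexI[of _ "Suc (M + nat \<lceil>real M - Re v\<rceil>)"])
  ultimately show ?thesis
    by (metis UNIV_eq_I)
qed

text \<open>At \<open>s = 0\<close> the series acts on the polynomial \<open>w ^ M\<close>: all
  terms of order above \<open>M\<close> vanish, and the remaining powers of \<open>- w\<close> over
  factorials are coefficients of \<open>fps_exp (- w)\<close>, so a Cauchy product appears.\<close>

lemma numerator_minus_of_nat:
  "numerator (- of_nat M) = (-1) ^ M * fact M * fps_nth (bernoulli_fps * fps_exp (- w)) M"
proof -
  \<comment> \<open>The least order whose half-plane \<open>Re v > M - L\<close> contains
    \<open>- M\<close>.\<close>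
  define L where "L = Suc (2 * M)"
  let ?v = "- of_nat M :: complex"
  have L: "M < L" "Re ?v + real L \<ge> 0" "Re ?v > real M - real L"
    by (auto simp: L_def)
  have zero: "pochhammer ?v m = 0" if "m > M" for m
    using that by (simp add: pochhammer_minus_of_nat)
  obtain C where C: "C \<ge> 0"
    "\<And>v z. Re z > 0 \<Longrightarrow> Re v + real L \<ge> 0 \<Longrightarrow> cmod (defect L v z) \<le> C * powr_err L v z"
    using defect_bound[OF L(1)] by blast
  \<comment> \<open>The factor \<open>pochhammer v L\<close> kept in \<open>powr_err\<close> makes
    the upper bound itself 0.\<close>
  have "defect L ?v (lattice_pt M a w k) = 0" for k
  proof -
    have "cmod (defect L ?v (lattice_pt M a w k)) \<le> C * powr_err L ?v (lattice_pt M a w k)"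
      using Re_lattice_pt_ge[of M a w k, OF a_pos] w_pos L(2) by (intro C) auto
    also have "\<dots> = 0"
      using zero[OF L(1)] by (simp add: powr_err_def)
    finally show ?thesis by simp
  qed
  then have "numerator ?v = fps_act L bernoulli_fps ?v w"
    by (simp add: numerator_eq_numerator_approx[OF L(1,3)] numerator_approx_def)
  also have "\<dots> = (\<Sum>m\<le>M. fps_nth bernoulli_fps m * neg_deriv_powr m ?v w)"
    unfolding fps_act_def
    by (rule sum.mono_neutral_right) (use L zero in \<open>auto simp: neg_deriv_powr_def\<close>)
  also have "\<dots> = (\<Sum>m\<le>M. (-1) ^ M * fact M * (fps_nth bernoulli_fps m * ((- w) ^ (M - m) / fact (M - m))))"
  proof (rule sum.cong)
    fix m assume "m \<in> {..M}"
    then have m: "m \<le> M" by simp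
    have "w powr (- (?v + of_nat m)) = w ^ (M - m)"
      using w_pos m by (subst powr_nat'[symmetric]) (auto simp: of_nat_diff)
    moreover have "pochhammer ?v m = (-1) ^ m * fact M / fact (M - m)"
      using m by (simp add: pochhammer_minus_of_nat binomial_fact)
    moreover have "(- 1) ^ M * (- w) ^ (M - m) = (-1) ^ m * w ^ (M - m)"
    proof -
      have "(-1 :: complex) ^ M = (-1) ^ m * (-1) ^ (M - m)"
        using m by (simp flip: power_add)
      moreover have "(-1) ^ (M - m) * (-1) ^ (M - m) = (1 :: complex)"
        by (simp flip: power_add mult_2)
      ultimately show ?thesis
        by (simp add: power_minus[of w])
    qed
    ultimately show "fps_nth bernoulli_fps m * neg_deriv_powr m ?v w =
        (-1) ^ M * fact M * (fps_nth bernoulli_fps m * ((- w) ^ (M - m) / fact (M - m)))"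
      by (simp add: neg_deriv_powr_def field_simps)
  qed simp
  also have "\<dots> = (-1) ^ M * fact M * fps_nth (bernoulli_fps * fps_exp (- w)) M"
    by (simp add: fps_mult_nth atLeast0AtMost sum_distrib_left)
  finally show ?thesis .
qed

section \<open>Division by the Pochhammer factor and identification with
  \<open>barnes_zeta\<close>\<close>

definition continued_zeta :: "complex \<Rightarrow> complex" where
  "continued_zeta = remove_sings (\<lambda>s. numerator (s - of_nat M) / pochhammer (s - of_nat M) M)"

lemma numerator_shift_analytic: "(\<lambda>s. numerator (s - of_nat M)) analytic_on A"
proof -
  have "numerator \<circ> (\<lambda>s. s - of_nat M) holomorphic_on UNIV"
    by (intro holomorphic_on_compose_gen[OF _ numerator_holomorphic] holomorphic_intros) auto
  then have "(\<lambda>s. numerator (s - of_nat M)) analytic_on UNIV"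
    by (simp add: analytic_on_open o_def)
  then show ?thesis
    by (rule analytic_on_subset) simp
qed

lemma pochhammer_shift_analytic: "(\<lambda>s. pochhammer (s - of_nat M) M :: complex) analytic_on A"
  unfolding pochhammer_prod by (intro analytic_intros)

text \<open>The denominator vanishes exactly at \<open>s = 1, ..., M\<close>. There
  \<open>remove_sings\<close> fills in removable singularities and puts 0 at poles, the
  normalization used in \<open>barnes_zeta\<close>.\<close>

lemma continued_zeta_nicely_meromorphic: "continued_zeta nicely_meromorphic_on UNIV"
  unfolding continued_zeta_def
  by (intro remove_sings_nicely_meromorphic meromorphic_on_divide analytic_on_imp_meromorphic_on
      numerator_shift_analytic pochhammer_shift_analytic)

lemma analytic_quotient:
  assumes "pochhammer (s - of_nat M) M \<noteq> 0"
  shows "(\<lambda>s. numerator (s - of_nat M) / pochhammer (s - of_nat M) M) analytic_on {s}"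
  using assms
  by (intro analytic_on_divide numerator_shift_analytic pochhammer_shift_analytic) auto

lemma continued_zeta_eq_series:
  assumes "Re s > real M"
  shows "continued_zeta s = barnes_zeta_series M s w a"
proof -
  have nz: "pochhammer (s - of_nat M) M \<noteq> 0"
  proof -
    have "s - of_nat M \<noteq> - of_nat k" for k
      using assms by (auto simp: complex_eq_iff)
    then show ?thesis
      by (auto simp: pochhammer_eq_0_iff)
  qed
  have L: "Re (s - of_nat M) > real M - real (Suc (2 * M))"
    using assms by simp
  have "continued_zeta s = numerator (s - of_nat M) / pochhammer (s - of_nat M) M"
    unfolding continued_zeta_def by (intro remove_sings_at_analytic analytic_quotient nz)
  also have "numerator (s - of_nat M) =
      (\<Sum>\<^sub>\<infinity>k\<in>lattice. neg_deriv_powr M (s - of_nat M) (lattice_pt M a w k))"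
    using assms numerator_eq_numerator_approx[OF _ L]
      numerator_approx_eq_series[of "Suc (2 * M)" "s - of_nat M"] by simp
  also have "\<dots> = pochhammer (s - of_nat M) M * (\<Sum>\<^sub>\<infinity>k\<in>lattice. lattice_pt M a w k powr (- s))"
    by (simp add: neg_deriv_powr_def infsum_cmult_right')
  finally show ?thesis
    using nz by (simp add: barnes_zeta_series_def lattice_pt_def)
qed

lemma barnes_zeta_eq: "barnes_zeta M s w a = continued_zeta s"
proof -
  have "(THE Z. Z nicely_meromorphic_on UNIV \<and>
      (\<forall>s. Re s > real M \<longrightarrow> Z s = barnes_zeta_series M s w a)) = continued_zeta"
    using continued_zeta_nicely_meromorphic continued_zeta_eq_series
    by (intro the_equality) (auto intro: nicely_meromorphic_eqI[where c = "real M"])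
  then show ?thesis
    by (simp add: barnes_zeta_def)
qed

lemma pochhammer_0_nonzero: "pochhammer (0 - of_nat M :: complex) M \<noteq> 0"
  using pochhammer_minus_of_nat[of M M] by simp

lemma continued_zeta_analytic_0: "continued_zeta analytic_on {0}"
  unfolding continued_zeta_def by (intro remove_sings_analytic_on analytic_quotient pochhammer_0_nonzero)

lemma continued_zeta_0: "continued_zeta 0 = fps_nth (bernoulli_fps * fps_exp (- w)) M"
proof -
  have "continued_zeta 0 = numerator (0 - of_nat M) / pochhammer (0 - of_nat M) M"
    unfolding continued_zeta_def by (intro remove_sings_at_analytic analytic_quotient pochhammer_0_nonzero)
  then show ?thesis
    by (simp add: numerator_minus_of_nat pochhammer_minus_of_nat)
qed

text \<open>Away from 0 the generating function is the quotient of two functions whose expansions at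
  0 are known, so the division of power series yields its Taylor coefficients once the singularity
  is removed.\<close>

lemma multiple_bernoulli_eq: "multiple_bernoulli M M w a = fact M * continued_zeta 0"
proof -
  let ?f = "\<lambda>t. t ^ M * exp (- w * t)" and ?F = "fps_X ^ M * fps_exp (- w)"
  let ?g = "\<lambda>t. \<Prod>j=1..M. 1 - exp (- complex_of_real (a j) * t)"
  let ?q = "\<lambda>t. t ^ M * (\<Prod>j=1..M. inverse (1 - exp (- (of_real (a j) * t)))) * exp (- (w * t))"
  \<comment> \<open>The value at 0 that \<open>has_fps_expansion_divide\<close> prescribes for the
    quotient.\<close>
  define c where "c = fps_nth ?F (subdegree (denom_fps M)) / fps_nth (denom_fps M) (subdegree (denom_fps M))"
  define h where "h = (\<lambda>t. if t = 0 then c else ?f t / ?g t)"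
  have "?f has_fps_expansion ?F"
    by (intro fps_expansion_intros)
  moreover have "?g has_fps_expansion denom_fps M"
    unfolding denom_fps_def by (intro fps_expansion_intros)
  moreover have "subdegree (denom_fps M) \<le> subdegree ?F"
    by (simp add: subdegree_denom_fps fps_X_power_subdegree)
  ultimately have h: "h has_fps_expansion ?F / denom_fps M"
    unfolding h_def c_def by (rule has_fps_expansion_divide) (simp_all add: denom_fps_nonzero)
  have F: "?F / denom_fps M = bernoulli_fps * fps_exp (- w)"
    unfolding bernoulli_fps_def using denom_fps_dvd by (simp add: dvd_div_mult)
  have "(\<Prod>j=1..M. inverse (1 - exp (- (complex_of_real (a j) * t)))) = inverse (?g t)" for t
    using prod_inversef[of "\<lambda>j. 1 - exp (- (complex_of_real (a j) * t))" "{1..M}"]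
    by (simp add: o_def)
  then have qh: "?q t = h t" if "t \<noteq> 0" for t
    using that by (simp add: h_def field_class.field_divide_inverse mult_ac)
  have "eventually (\<lambda>t. ?q t = h t) (at z)" for z
    using qh eventually_neq_at_within[of 0 z UNIV] by (auto elim!: eventually_mono)
  then have "remove_sings ?q = remove_sings h"
    by (intro ext remove_sings_cong refl)
  \<comment> \<open>With this value \<open>h\<close> is analytic at 0, so
    \<open>remove_sings\<close> changes nothing near 0.\<close>
  moreover have "eventually (\<lambda>t. remove_sings h t = h t) (nhds 0)"
    by (intro eventually_remove_sings_eq_nhds has_fps_expansion_imp_analytic_0[OF h])
  ultimately have "remove_sings ?q has_fps_expansion bernoulli_fps * fps_exp (- w)"
    using h F has_fps_expansion_cong[of "remove_sings ?q" h] by simp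
  then have "fps_nth (bernoulli_fps * fps_exp (- w)) M = (deriv ^^ M) (remove_sings ?q) 0 / fact M"
    by (rule fps_nth_fps_expansion)
  then show ?thesis
    by (simp add: multiple_bernoulli_def continued_zeta_0)
qed

end

section \<open>Homogeneity in \<open>s\<close> and its derivative at \<open>s = 0\<close>\<close>

theorem theorem2p2:
  fixes M :: nat and a :: "nat \<Rightarrow> real" and w :: complex and \<kappa> :: real
  assumes "\<And>j. j \<in> {1..M} \<Longrightarrow> a j > 0"
    and "Re w > 0"
    and "\<kappa> > 0"
  shows "barnes_Gamma M (of_real \<kappa> * w) (\<lambda>j. \<kappa> * a j) =
           of_real \<kappa> powr (- (multiple_bernoulli M M w a / fact M)) * barnes_Gamma M w a"
proof -
  interpret Z: barnes_parameters M a w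
    using assms by unfold_locales auto
  interpret K: barnes_parameters M "\<lambda>j. \<kappa> * a j" "of_real \<kappa> * w"
    using assms by unfold_locales auto
  let ?k = "complex_of_real \<kappa>"
  have k: "?k \<noteq> 0"
    using assms by simp
  have B: "multiple_bernoulli M M w a / fact M = Z.continued_zeta 0"
    by (simp add: Z.multiple_bernoulli_eq)
  show ?thesis
  proof (cases "M = 0")
    \<comment> \<open>Here \<open>barnes_Gamma\<close> is given by \<open>1 / w\<close> and the
      exponent is -1.\<close>
    case True
    have "Z.bernoulli_fps = 1"
      using Z.bernoulli_fps_mult_denom_fps True by (simp add: Z.denom_fps_def)
    then have "Z.continued_zeta 0 = 1"
      unfolding Z.continued_zeta_0 using True by simp
    then show ?thesis
      unfolding B using True k by (simp add: barnes_Gamma_def powr_minus field_simps)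
  next
    case False
    have pt: "lattice_pt M (\<lambda>j. \<kappa> * a j) (?k * w) k = ?k * lattice_pt M a w k" for k
      by (simp add: lattice_pt_def sum_distrib_left algebra_simps)
    have "K.continued_zeta s = ?k powr (- s) * Z.continued_zeta s" if "Re s > real M" for s
    proof -
      have "K.continued_zeta s = (\<Sum>\<^sub>\<infinity>k\<in>Z.lattice. (?k * lattice_pt M a w k) powr (- s))"
        using K.continued_zeta_eq_series[OF that]
        by (simp add: barnes_zeta_series_def flip: pt) (simp add: lattice_pt_def)
      \<comment> \<open>No branch correction arises, as \<kappa> is a positive real.\<close>
      also have "\<dots> = ?k powr (- s) * (\<Sum>\<^sub>\<infinity>k\<in>Z.lattice. lattice_pt M a w k powr (- s))"
        using assms by (simp add: powr_times_real_left infsum_cmult_right')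
      finally show ?thesis
        using Z.continued_zeta_eq_series[OF that] by (simp add: barnes_zeta_series_def lattice_pt_def)
    qed
    moreover have ana: "(\<lambda>s. ?k powr (- s)) analytic_on UNIV"
      by (simp add: analytic_on_open holomorphic_intros)
    ultimately have "eventually (\<lambda>s. K.continued_zeta s = ?k powr (- s) * Z.continued_zeta s) (at 0)"
      using K.continued_zeta_nicely_meromorphic Z.continued_zeta_nicely_meromorphic
        analytic_on_imp_meromorphic_on[OF ana]
      by (intro meromorphic_eq_halfplane_imp_eq[where c = "real M"] meromorphic_on_mult)
        (auto simp: nicely_meromorphic_on_def)
    moreover have ana0: "(\<lambda>s. ?k powr (- s) * Z.continued_zeta s) analytic_on {0}"
      using Z.continued_zeta_analytic_0 analytic_on_subset[OF ana] by (intro analytic_on_mult) auto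
    \<comment> \<open>Differentiating at 0 needs equality on a full neighbourhood; both sides are
      analytic at 0, so they also agree at 0 itself.\<close>
    ultimately have ev: "eventually (\<lambda>s. K.continued_zeta s = ?k powr (- s) * Z.continued_zeta s) (nhds 0)"
      using remove_sings_at_analytic[OF K.continued_zeta_analytic_0] remove_sings_at_analytic[OF ana0]
        remove_sings_cong[of K.continued_zeta "\<lambda>s. ?k powr (- s) * Z.continued_zeta s" 0 0]
      by (simp add: eventually_nhds_conv_at)
    have "deriv K.continued_zeta 0 = deriv (\<lambda>s. ?k powr (- s) * Z.continued_zeta s) 0"
      using ev by (rule deriv_cong_ev) simp
    also have "\<dots> = - Ln ?k * Z.continued_zeta 0 + deriv Z.continued_zeta 0"
    proof (rule DERIV_imp_deriv)
      have "(Z.continued_zeta has_field_derivative deriv Z.continued_zeta 0) (at 0)"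
        using Z.continued_zeta_analytic_0 analytic_on_imp_differentiable_at
        by (simp add: DERIV_deriv_iff_field_differentiable)
      moreover have "((\<lambda>s. ?k powr (- s)) has_field_derivative Ln ?k * ?k powr (- 0) * - 1) (at 0)"
        by (rule DERIV_chain2[OF has_field_derivative_powr_right[OF k] DERIV_minus[OF DERIV_ident]])
      ultimately show "((\<lambda>s. ?k powr (- s) * Z.continued_zeta s) has_field_derivative
          - Ln ?k * Z.continued_zeta 0 + deriv Z.continued_zeta 0) (at 0)"
        using k by (auto dest: DERIV_mult simp: add.commute)
    qed
    finally have "barnes_L M (?k * w) (\<lambda>j. \<kappa> * a j) = - Ln ?k * Z.continued_zeta 0 + barnes_L M w a"
      by (simp add: barnes_L_def K.barnes_zeta_eq Z.barnes_zeta_eq)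
    then show ?thesis
      unfolding B using False k by (simp add: barnes_Gamma_def powr_def exp_add [symmetric] mult.commute)
  qed
qed

end
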